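(* Assume conditions (C) and (P) hold and that $\chi(0)<0$. Let $\phi$ be a bounded solution of (E) with $\phi(t)\geq 0$ for all $t$. Then either $\liminf_{t\to+\infty}\phi(t)>0$ or $\lim_{t\to+\infty}\phi(t)=0$. Likewise, either $\liminf_{t\to-\infty}\phi(t)>0$ or $\lim_{t\to-\infty}\phi(t)=0$.
   Context: Let $(X,\mu)$ be a finite measure space. Let $K:\mathbb{R}\times X\to[0,\infty)$ be measurable and integrable on $\mathbb{R}\times X$, with $\int_{\mathbb{R}}K(s,\tau)\,ds>0$ for every $\tau\in X$. Let $g:[0,\infty)\times X\to[0,\infty)$ be measurable, with $g(0,\tau)=0$ for all $\tau$, $g(\cdot,\tau)$ continuous for each fixed $\tau$, and such that the derivative $g'(0,\tau)$ of $g(\cdot,\tau)$ at $0$ exists and is positive for each $\tau$. Equation (E) is $\phi(t)=\int_X d\mu(\tau)\int_{\mathbb{R}}K(s,\tau)\,g(\phi(t-s),\tau)\,ds$, $t\in\mathbb{R}$; a solution is a continuous function $\phi:\mathbb{R}\to[0,\infty)$ satisfying (E) for every $t$. The characteristic function is $\chi(z)=1-\int_X\int_{\mathbb{R}}K(s,\tau)g'(0,\tau)e^{-sz}\,ds\,d\mu(\tau)$ for real $z$ where the integral converges. Condition (C): for each $\delta>0$ there is a measurable $C_\delta:X\to[0,\infty)$ with $g(u,\tau)\leq C_\delta(\tau)u$ for $u\in[0,\delta]$, $\tau\in X$, and $\int_X C_\delta(\tau)\left(\int_{\mathbb{R}}K(s,\tau)ds\right)d\mu(\tau)<+\infty$.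 Condition (P): every bounded solution $\phi\geq 0$ of (E) that vanishes at some point is identically zero. *)

theory Defs
  imports "HOL-Analysis.Analysis"
begin

text \<open>Standing assumptions on the kernel K and the nonlinearity g (paper's hypotheses).
  g is only meaningful on [0,\<infinity>); dg \<tau> is the (right) derivative g'(0,\<tau>).\<close>
definition standing_hyps ::
  "'a measure \<Rightarrow> (real \<Rightarrow> 'a \<Rightarrow> real) \<Rightarrow> (real \<Rightarrow> 'a \<Rightarrow> real) \<Rightarrow> ('a \<Rightarrow> real) \<Rightarrow> bool" where
  "standing_hyps M K g dg \<longleftrightarrow>
     finite_measure M \<and>
     (\<lambda>(s,\<tau>). K s \<tau>) \<in> borel_measurable (lborel \<Otimes>\<^sub>M M) \<and>
     (\<forall>s. \<forall>\<tau>\<in>space M. K s \<tau> \<ge> 0) \<and>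
     integrable (lborel \<Otimes>\<^sub>M M) (\<lambda>(s,\<tau>). K s \<tau>) \<and>
     (\<forall>\<tau>\<in>space M. (\<integral>\<^sup>+ s. ennreal (K s \<tau>) \<partial>lborel) > 0) \<and>
     (\<lambda>(u,\<tau>). g u \<tau>) \<in> borel_measurable (restrict_space borel {0..} \<Otimes>\<^sub>M M) \<and>
     (\<forall>u\<ge>0. \<forall>\<tau>\<in>space M. g u \<tau> \<ge> 0) \<and>
     (\<forall>\<tau>\<in>space M. g 0 \<tau> = 0) \<and>
     (\<forall>\<tau>\<in>space M. continuous_on {0..} (\<lambda>u. g u \<tau>)) \<and>
     (\<forall>\<tau>\<in>space M. ((\<lambda>u. g u \<tau>) has_real_derivative dg \<tau>) (at 0 within {0..}) \<and> dg \<tau> > 0)"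

text \<open>A solution of (E): continuous, nonnegative, satisfying the equation for every t.
  The integrand is nonnegative, so the iterated integral is taken as a nonnegative
  (extended) integral; the equation forces it to be finite.\<close>
definition is_solution ::
  "'a measure \<Rightarrow> (real \<Rightarrow> 'a \<Rightarrow> real) \<Rightarrow> (real \<Rightarrow> 'a \<Rightarrow> real) \<Rightarrow> (real \<Rightarrow> real) \<Rightarrow> bool" where
  "is_solution M K g \<phi> \<longleftrightarrow>
     continuous_on UNIV \<phi> \<and> (\<forall>t. \<phi> t \<ge> 0) \<and>
     (\<forall>t. ennreal (\<phi> t) =
          (\<integral>\<^sup>+ \<tau>. (\<integral>\<^sup>+ s. ennreal (K s \<tau> * g (\<phi> (t - s)) \<tau>) \<partial>lborel) \<partial>M))"

definition cond_C ::
  "'a measure \<Rightarrow> (real \<Rightarrow> 'a \<Rightarrow> real) \<Rightarrow> (real \<Rightarrow> 'a \<Rightarrow> real) \<Rightarrow> bool" where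
  "cond_C M K g \<longleftrightarrow>
     (\<forall>\<delta>>0. \<exists>C. C \<in> borel_measurable M \<and> (\<forall>\<tau>\<in>space M. C \<tau> \<ge> 0) \<and>
        (\<forall>u\<in>{0..\<delta>}. \<forall>\<tau>\<in>space M. g u \<tau> \<le> C \<tau> * u) \<and>
        (\<integral>\<^sup>+ \<tau>. ennreal (C \<tau>) * (\<integral>\<^sup>+ s. ennreal (K s \<tau>) \<partial>lborel) \<partial>M) < \<infinity>)"

definition cond_P ::
  "'a measure \<Rightarrow> (real \<Rightarrow> 'a \<Rightarrow> real) \<Rightarrow> (real \<Rightarrow> 'a \<Rightarrow> real) \<Rightarrow> bool" where
  "cond_P M K g \<longleftrightarrow>
     (\<forall>\<phi>. is_solution M K g \<phi> \<and> bounded (range \<phi>) \<and> (\<exists>t. \<phi> t = 0) \<longrightarrow> (\<forall>t. \<phi> t = 0))"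

definition chi0_neg ::
  "'a measure \<Rightarrow> (real \<Rightarrow> 'a \<Rightarrow> real) \<Rightarrow> ('a \<Rightarrow> real) \<Rightarrow> bool" where
  "chi0_neg M K dg \<longleftrightarrow>
     (let I = (\<integral>\<^sup>+ \<tau>. (\<integral>\<^sup>+ s. ennreal (K s \<tau> * dg \<tau>) \<partial>lborel) \<partial>M) in I < \<infinity> \<and> 1 - enn2real I < 0)"

end

theory Submission
  imports Defs "HOL-Complex_Analysis.Great_Picard"
begin

text \<open>
  A bounded solution is uniformly continuous, by the continuity of translations in \<open>L\<^sup>1\<close>, so
  every sequence of its translates has a subsequence converging to another bounded solution.
  Condition (P) for such limits gives a uniform propagation of smallness: if \<open>\<phi> t\<close> is small then
  \<open>\<phi>\<close> is small on a long interval around \<open>t\<close>. If the dichotomy failed, there would be arbitrarily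
  deep dips of \<open>\<phi>\<close> between two points where \<open>\<phi> \<ge> \<epsilon>\<close>. By propagation, the minimum point \<open>m\<close>
  over such a dip is also the minimum over a long interval centred at \<open>m\<close>. Dividing (E) at \<open>m\<close> by
  \<open>\<phi> m\<close> and using \<open>\<phi> (m - s) \<ge> \<phi> m\<close>, Fatou's lemma along ever deeper dips yields
  \<open>1 - \<chi>(0) \<le> 1\<close>, contrary to \<open>\<chi>(0) < 0\<close>.
\<close>

section \<open>Continuity of translations in L1 of the real line\<close>

lemma nn_integral_lborel_translate:
  fixes f :: "real \<Rightarrow> ennreal"
  assumes "f \<in> borel_measurable borel"
  shows "(\<integral>\<^sup>+x. f (x + t) \<partial>lborel) = (\<integral>\<^sup>+x. f x \<partial>lborel)"
  using nn_integral_real_affine[OF assms, of 1 t] by (simp add: add.commute)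

text \<open>Closure step for the density argument below. The error splits into the translated
  approximation error, the translation error of \<open>g\<close>, and the approximation error. By
  translation invariance the first and third have the same integral, so each term gets a third of
  \<open>e\<close>.\<close>

lemma L1_translation_tendsto_approx:
  fixes f :: "real \<Rightarrow> real" and h :: "nat \<Rightarrow> real"
  assumes [measurable]: "f \<in> borel_measurable borel"
    and approx: "\<And>e. e > 0 \<Longrightarrow> \<exists>g\<in>borel_measurable borel.
        (\<integral>\<^sup>+s. ennreal \<bar>f s - g s\<bar> \<partial>lborel) < ennreal e \<and>
        (\<lambda>n. \<integral>\<^sup>+s. ennreal \<bar>g (s + h n) - g s\<bar> \<partial>lborel) \<longlonglongrightarrow> 0"
  shows "(\<lambda>n. \<integral>\<^sup>+s. ennreal \<bar>f (s + h n) - f s\<bar> \<partial>lborel) \<longlonglongrightarrow> 0"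
proof (rule tendsto_zero_ennreal)
  fix e :: real assume "e > 0"
  then obtain g where g[measurable]: "g \<in> borel_measurable borel"
    and fg: "(\<integral>\<^sup>+s. ennreal \<bar>f s - g s\<bar> \<partial>lborel) < ennreal (e/3)"
    and lim: "(\<lambda>n. \<integral>\<^sup>+s. ennreal \<bar>g (s + h n) - g s\<bar> \<partial>lborel) \<longlonglongrightarrow> 0"
    using approx[of "e/3"] by auto
  have "ennreal (e/3) > 0" using \<open>e > 0\<close> by simp
  then have "\<forall>\<^sub>F n in sequentially. (\<integral>\<^sup>+s. ennreal \<bar>g (s + h n) - g s\<bar> \<partial>lborel) < ennreal (e/3)"
    using lim order_tendstoD(2) by blast
  then show "\<forall>\<^sub>F n in sequentially. (\<integral>\<^sup>+s. ennreal \<bar>f (s + h n) - f s\<bar> \<partial>lborel) < ennreal e"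
  proof eventually_elim
    case (elim n)
    have "(\<integral>\<^sup>+s. ennreal \<bar>f (s + h n) - f s\<bar> \<partial>lborel)
        \<le> (\<integral>\<^sup>+s. ennreal \<bar>f (s + h n) - g (s + h n)\<bar> + ennreal \<bar>g (s + h n) - g s\<bar>
              + ennreal \<bar>f s - g s\<bar> \<partial>lborel)"
      by (intro nn_integral_mono) (simp flip: ennreal_plus)
    also have "\<dots> = (\<integral>\<^sup>+s. ennreal \<bar>f (s + h n) - g (s + h n)\<bar> \<partial>lborel)
        + (\<integral>\<^sup>+s. ennreal \<bar>g (s + h n) - g s\<bar> \<partial>lborel) + (\<integral>\<^sup>+s. ennreal \<bar>f s - g s\<bar> \<partial>lborel)"
      by (simp add: nn_integral_add)
    also have "(\<integral>\<^sup>+s. ennreal \<bar>f (s + h n) - g (s + h n)\<bar> \<partial>lborel) = (\<integral>\<^sup>+s. ennreal \<bar>f s - g s\<bar> \<partial>lborel)"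
      using nn_integral_lborel_translate[of "\<lambda>s. ennreal \<bar>f s - g s\<bar>" "h n"] by simp
    also have "\<dots> + (\<integral>\<^sup>+s. ennreal \<bar>g (s + h n) - g s\<bar> \<partial>lborel) + (\<integral>\<^sup>+s. ennreal \<bar>f s - g s\<bar> \<partial>lborel)
        < ennreal (e/3) + ennreal (e/3) + ennreal (e/3)"
      using fg elim by (intro add_strict_mono)
    also have "\<dots> = ennreal e" using \<open>e > 0\<close> by (simp flip: ennreal_plus)
    finally show ?case .
  qed
qed

text \<open>A point of an open set stays in it under all sufficiently small shifts, so the part of
  \<open>U\<close> that a shift loses vanishes pointwise, and dominated convergence applies because
  \<open>U\<close> has finite measure.\<close>

lemma L1_translation_tendsto_open:
  fixes U :: "real set" and h :: "nat \<Rightarrow> real"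
  assumes "open U" and fin: "emeasure lborel U < \<infinity>" and h: "h \<longlonglongrightarrow> 0"
  shows "(\<lambda>n. \<integral>\<^sup>+s. ennreal \<bar>indicat_real U (s + h n) - indicat_real U s\<bar> \<partial>lborel) \<longlonglongrightarrow> 0"
proof -
  have [measurable]: "U \<in> sets borel" using \<open>open U\<close> by simp
  \<comment> \<open>Stated for an arbitrary null sequence \<open>k\<close>, because it is applied
    both to \<open>h\<close> and to its negative.\<close>
  have lim: "(\<lambda>n. \<integral>\<^sup>+s. ennreal (indicator U s * (1 - indicator U (s + k n))) \<partial>lborel) \<longlonglongrightarrow> 0"
    if k: "k \<longlonglongrightarrow> 0" for k :: "nat \<Rightarrow> real"
  proof -
    have "(\<lambda>n. \<integral>\<^sup>+s. ennreal (indicator U s * (1 - indicator U (s + k n))) \<partial>lborel)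
        \<longlonglongrightarrow> (\<integral>\<^sup>+s. 0 \<partial>(lborel :: real measure))"
    proof (rule nn_integral_dominated_convergence[where w="\<lambda>s. indicator U s"])
      show "AE s in lborel. (\<lambda>n. ennreal (indicator U s * (1 - indicator U (s + k n)))) \<longlonglongrightarrow> 0"
      proof (rule AE_I2, cases)
        fix s assume "s \<in> U"
        have "(\<lambda>n. s + k n) \<longlonglongrightarrow> s + 0" by (intro tendsto_intros k)
        then have "\<forall>\<^sub>F n in sequentially. s + k n \<in> U"
          using \<open>open U\<close> \<open>s \<in> U\<close> topological_tendstoD by fastforce
        then have "\<forall>\<^sub>F n in sequentially. ennreal (indicator U s * (1 - indicator U (s + k n))) = 0"
          by eventually_elim simp
        then show "(\<lambda>n. ennreal (indicator U s * (1 - indicator U (s + k n)))) \<longlonglongrightarrow> 0"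
          by (rule tendsto_eventually)
      qed simp
      show "(\<integral>\<^sup>+s. indicator U s \<partial>lborel) < \<infinity>" using fin by simp
      show "AE s in lborel. ennreal (indicator U s * (1 - indicator U (s + k n))) \<le> indicator U s" for n
        by (auto simp: indicator_def)
    qed auto
    then show ?thesis by simp
  qed
  \<comment> \<open>The symmetric difference consists of the points lost and the points gained; a
    translation by \<open>h n\<close> turns the gain into the loss for the opposite shift.\<close>
  have eq: "(\<integral>\<^sup>+s. ennreal \<bar>indicat_real U (s + h n) - indicat_real U s\<bar> \<partial>lborel)
      = (\<integral>\<^sup>+s. ennreal (indicator U s * (1 - indicator U (s + h n))) \<partial>lborel)
        + (\<integral>\<^sup>+s. ennreal (indicator U s * (1 - indicator U (s + - h n))) \<partial>lborel)" for n
  proof -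
    have "(\<integral>\<^sup>+s. ennreal \<bar>indicat_real U (s + h n) - indicat_real U s\<bar> \<partial>lborel)
      = (\<integral>\<^sup>+s. ennreal (indicator U s * (1 - indicator U (s + h n)))
          + ennreal (indicator U (s + h n) * (1 - indicator U s)) \<partial>lborel)"
      by (intro nn_integral_cong) (auto simp: indicator_def)
    also have "\<dots> = (\<integral>\<^sup>+s. ennreal (indicator U s * (1 - indicator U (s + h n))) \<partial>lborel)
        + (\<integral>\<^sup>+s. ennreal (indicator U (s + h n) * (1 - indicator U s)) \<partial>lborel)"
      by (rule nn_integral_add) auto
    also have "(\<integral>\<^sup>+s. ennreal (indicator U (s + h n) * (1 - indicator U s)) \<partial>lborel)
        = (\<integral>\<^sup>+s. ennreal (indicator U s * (1 - indicator U (s + - h n))) \<partial>lborel)"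
      using nn_integral_lborel_translate[of "\<lambda>s. ennreal (indicator U s * (1 - indicator U (s + - h n)))" "h n"]
      by simp
    finally show ?thesis .
  qed
  have "(\<lambda>n. - h n) \<longlonglongrightarrow> 0" using tendsto_minus[OF h] by simp
  from tendsto_add[OF lim[OF h] lim[OF this]] show ?thesis unfolding eq by simp
qed

text \<open>Induction over integrable functions: outer regularity reduces measurable sets of finite
  measure to open ones, the triangle inequality handles sums, and the closure step handles
  limits.\<close>

lemma L1_translation_tendsto:
  fixes f :: "real \<Rightarrow> real" and h :: "nat \<Rightarrow> real"
  assumes f: "integrable lborel f" and h: "h \<longlonglongrightarrow> 0"
  shows "(\<lambda>n. \<integral>\<^sup>+s. ennreal \<bar>f (s + h n) - f s\<bar> \<partial>lborel) \<longlonglongrightarrow> 0"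
  using f
proof (induction rule: integrable_induct)
  case (base A c)
  have [measurable]: "A \<in> sets borel" using base by simp
  have ind: "(\<lambda>n. \<integral>\<^sup>+s. ennreal \<bar>indicat_real A (s + h n) - indicat_real A s\<bar> \<partial>lborel) \<longlonglongrightarrow> 0"
  proof (rule L1_translation_tendsto_approx)
    fix e :: real assume "e > 0"
    then obtain U where U: "open U" "A \<subseteq> U" "emeasure lborel (U - A) < e"
      using outer_regular_lborel[of A e] by auto
    have [measurable]: "U \<in> sets borel" using \<open>open U\<close> by simp
    have "emeasure lborel U = emeasure lborel A + emeasure lborel (U - A)"
      using U plus_emeasure[of A lborel "U - A"] by (simp add: Un_absorb1)
    also have "\<dots> < \<infinity>" using base U(3) by (simp add: less_top order_less_trans)
    finally have "emeasure lborel U < \<infinity>" .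
    moreover have "(\<integral>\<^sup>+s. ennreal \<bar>indicat_real A s - indicat_real U s\<bar> \<partial>lborel)
        = (\<integral>\<^sup>+s. indicator (U - A) s \<partial>lborel)"
      using U(2) by (intro nn_integral_cong) (auto simp: indicator_def)
    ultimately show "\<exists>g\<in>borel_measurable borel.
        (\<integral>\<^sup>+s. ennreal \<bar>indicat_real A s - g s\<bar> \<partial>lborel) < ennreal e \<and>
        (\<lambda>n. \<integral>\<^sup>+s. ennreal \<bar>g (s + h n) - g s\<bar> \<partial>lborel) \<longlonglongrightarrow> 0"
      using U h by (intro bexI[of _ "indicat_real U"]) (auto intro: L1_translation_tendsto_open)
  qed simp
  have "(\<integral>\<^sup>+s. ennreal \<bar>indicator A (s + h n) *\<^sub>R c - indicator A s *\<^sub>R c\<bar> \<partial>lborel)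
      = ennreal \<bar>c\<bar> * (\<integral>\<^sup>+s. ennreal \<bar>indicat_real A (s + h n) - indicat_real A s\<bar> \<partial>lborel)" for n
    by (subst nn_integral_cmult[symmetric])
      (auto intro!: nn_integral_cong simp: mult.commute[of _ c] simp flip: ennreal_mult abs_mult right_diff_distrib)
  then show ?case
    using ennreal_tendsto_cmult[OF _ ind, of "ennreal \<bar>c\<bar>"] by simp
next
  case (add f g)
  have [measurable]: "f \<in> borel_measurable borel" "g \<in> borel_measurable borel"
    using add by auto
  show ?case
  proof (rule tendsto_sandwich[where f="\<lambda>_. 0"])
    show "\<forall>\<^sub>F n in sequentially. (\<integral>\<^sup>+s. ennreal \<bar>f (s + h n) + g (s + h n) - (f s + g s)\<bar> \<partial>lborel)
      \<le> (\<integral>\<^sup>+s. ennreal \<bar>f (s + h n) - f s\<bar> \<partial>lborel) + (\<integral>\<^sup>+s. ennreal \<bar>g (s + h n) - g s\<bar> \<partial>lborel)"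
      by (intro always_eventually allI, subst nn_integral_add[symmetric])
        (auto intro!: nn_integral_mono simp flip: ennreal_plus)
    show "(\<lambda>n. (\<integral>\<^sup>+s. ennreal \<bar>f (s + h n) - f s\<bar> \<partial>lborel)
        + (\<integral>\<^sup>+s. ennreal \<bar>g (s + h n) - g s\<bar> \<partial>lborel)) \<longlonglongrightarrow> 0"
      using tendsto_add[OF add.IH] by simp
  qed auto
next
  case (lim f u)
  have [measurable]: "f \<in> borel_measurable borel" "\<And>i. u i \<in> borel_measurable borel"
    using lim by auto
  \<comment> \<open>The induction scheme supplies \<open>u i\<close> bounded in norm by twice
    \<open>f\<close>, which is the dominating function here.\<close>
  have "(\<lambda>i. \<integral>\<^sup>+s. ennreal (norm (f s - u i s)) \<partial>lborel) \<longlonglongrightarrow> 0"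
  proof (rule nn_integral_dominated_convergence_norm[where w="\<lambda>s. 2 * norm (f s)"])
    show "(\<integral>\<^sup>+s. ennreal (2 * norm (f s)) \<partial>lborel) < \<infinity>"
      using \<open>integrable lborel f\<close> by (auto simp: integrable_iff_bounded ennreal_mult nn_integral_cmult ennreal_mult_less_top)
  qed (use lim in auto)
  then have lim0: "(\<lambda>i. \<integral>\<^sup>+s. ennreal \<bar>f s - u i s\<bar> \<partial>lborel) \<longlonglongrightarrow> 0" by simp
  show ?case
  proof (rule L1_translation_tendsto_approx)
    fix e :: real assume "e > 0"
    then have "\<forall>\<^sub>F i in sequentially. (\<integral>\<^sup>+s. ennreal \<bar>f s - u i s\<bar> \<partial>lborel) < ennreal e"
      by (intro order_tendstoD(2)[OF lim0]) simp
    then obtain i where "(\<integral>\<^sup>+s. ennreal \<bar>f s - u i s\<bar> \<partial>lborel) < ennreal e"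
      by (auto dest: eventually_happens)
    with lim.IH show "\<exists>g\<in>borel_measurable borel.
        (\<integral>\<^sup>+s. ennreal \<bar>f s - g s\<bar> \<partial>lborel) < ennreal e \<and>
        (\<lambda>n. \<integral>\<^sup>+s. ennreal \<bar>g (s + h n) - g s\<bar> \<partial>lborel) \<longlonglongrightarrow> 0"
      by (intro bexI[of _ "u i"]) auto
  qed simp
qed

section \<open>Compactness of the family of translates\<close>

text \<open>An Arzela-Ascoli argument: a diagonal subsequence converges at all rationals, and the
  common modulus of continuity of the translates extends convergence to every real and passes to the
  limit.\<close>

lemma uniformly_continuous_translates_subsequence:
  fixes \<phi> :: "real \<Rightarrow> real"
  assumes uc: "uniformly_continuous_on UNIV \<phi>" and bd: "\<And>t. \<bar>\<phi> t\<bar> \<le> B"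
  obtains r \<psi> where "strict_mono (r :: nat \<Rightarrow> nat)" "continuous_on UNIV \<psi>"
    "\<And>t. (\<lambda>n. \<phi> (a (r n) + t)) \<longlonglongrightarrow> \<psi> t"
proof -
  obtain r :: "nat \<Rightarrow> nat" where r: "strict_mono r"
    and conv: "\<And>x. x \<in> \<rat> \<Longrightarrow> \<exists>l. (\<lambda>n. \<phi> (a (r n) + x)) \<longlonglongrightarrow> l"
    using function_convergent_subsequence[of "\<rat> :: real set" "\<lambda>n x. \<phi> (a n + x)" B] bd
    by (auto simp: countable_rat)
  have Cau: "Cauchy (\<lambda>n. \<phi> (a (r n) + x))" for x
  proof (rule metric_CauchyI)
    fix e :: real assume "e > 0"
    then obtain d where "d > 0" and d: "\<And>u v. dist u v < d \<Longrightarrow> dist (\<phi> u) (\<phi> v) < e/3"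
      using uc[unfolded uniformly_continuous_on_def, rule_format, of "e/3"] by auto
    \<comment> \<open>A rational within \<open>d\<close> of \<open>x\<close> carries the Cauchy
      property over to \<open>x\<close>, at a cost of \<open>e/3\<close> on either side, whatever
      the translate.\<close>
    obtain q where q: "q \<in> \<rat>" "x < q" "q < x + d"
      using Rats_dense_in_real[of x "x + d"] \<open>d > 0\<close> by auto
    have close: "dist (\<phi> (b + q)) (\<phi> (b + x)) < e/3" for b
      using q by (intro d) (simp add: dist_real_def)
    have "Cauchy (\<lambda>n. \<phi> (a (r n) + q))"
      using conv[OF q(1)] convergent_Cauchy convergentI by blast
    then obtain N where N: "\<And>m n. m \<ge> N \<Longrightarrow> n \<ge> N \<Longrightarrow> dist (\<phi> (a (r m) + q)) (\<phi> (a (r n) + q)) < e/3"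
      using metric_CauchyD[of _ "e/3"] \<open>e > 0\<close> by (metis divide_pos_pos zero_less_numeral)
    show "\<exists>N. \<forall>m\<ge>N. \<forall>n\<ge>N. dist (\<phi> (a (r m) + x)) (\<phi> (a (r n) + x)) < e"
    proof (intro exI allI impI)
      fix m n assume "m \<ge> N" "n \<ge> N"
      then show "dist (\<phi> (a (r m) + x)) (\<phi> (a (r n) + x)) < e"
        using N[of m n] close[of "a (r m)"] close[of "a (r n)"]
        by (simp add: dist_real_def abs_if split: if_splits)
    qed
  qed
  define \<psi> where "\<psi> x = lim (\<lambda>n. \<phi> (a (r n) + x))" for x
  have lim: "(\<lambda>n. \<phi> (a (r n) + x)) \<longlonglongrightarrow> \<psi> x" for x
    unfolding \<psi>_def using Cau[of x] by (simp add: Cauchy_convergent_iff convergent_LIMSEQ_iff)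
  have "uniformly_continuous_on UNIV \<psi>"
    unfolding uniformly_continuous_on_def
  proof (intro allI impI)
    fix e :: real assume "e > 0"
    then obtain d where "d > 0" and d: "\<And>u v. dist u v < d \<Longrightarrow> dist (\<phi> u) (\<phi> v) < e/2"
      using uc[unfolded uniformly_continuous_on_def, rule_format, of "e/2"] by auto
    have "dist (\<psi> u) (\<psi> v) < e" if "dist u v < d" for u v
    proof -
      have "dist (\<psi> u) (\<psi> v) \<le> e/2"
        using tendsto_dist[OF lim[of u] lim[of v]]
      proof (rule LIMSEQ_le_const2)
        show "\<exists>N. \<forall>n\<ge>N. dist (\<phi> (a (r n) + u)) (\<phi> (a (r n) + v)) \<le> e/2"
          using that by (intro exI allI impI less_imp_le d) simp
      qed
      then show ?thesis using \<open>e > 0\<close> by simp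
    qed
    then show "\<exists>d>0. \<forall>x\<in>UNIV. \<forall>x'\<in>UNIV. dist x' x < d \<longrightarrow> dist (\<psi> x') (\<psi> x) < e"
      using \<open>d > 0\<close> by blast
  qed
  then show thesis
    using that r lim uniformly_continuous_imp_continuous by blast
qed

section \<open>The equation as a product integral, and its integrable majorant\<close>

locale convolution_equation =
  fixes M :: "'a measure" and K g :: "real \<Rightarrow> 'a \<Rightarrow> real" and dg :: "'a \<Rightarrow> real"
  assumes hyps: "standing_hyps M K g dg" and cond_C: "cond_C M K g"
begin

sublocale finite_measure M using hyps by (simp add: standing_hyps_def)

sublocale P: pair_sigma_finite lborel M ..

lemma K_measurable [measurable]: "(\<lambda>p. K (fst p) (snd p)) \<in> borel_measurable (lborel \<Otimes>\<^sub>M M)"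
  and K_nonneg: "\<tau> \<in> space M \<Longrightarrow> 0 \<le> K s \<tau>"
  and K_integrable: "integrable (lborel \<Otimes>\<^sub>M M) (\<lambda>(s,\<tau>). K s \<tau>)"
  and g_measurable: "(\<lambda>(u,\<tau>). g u \<tau>) \<in> borel_measurable (restrict_space borel {0..} \<Otimes>\<^sub>M M)"
  and g_nonneg: "\<lbrakk>0 \<le> u; \<tau> \<in> space M\<rbrakk> \<Longrightarrow> 0 \<le> g u \<tau>"
  and g_continuous: "\<tau> \<in> space M \<Longrightarrow> continuous_on {0..} (\<lambda>u. g u \<tau>)"
  and g_zero: "\<tau> \<in> space M \<Longrightarrow> g 0 \<tau> = 0"
  and g_deriv: "\<tau> \<in> space M \<Longrightarrow> ((\<lambda>u. g u \<tau>) has_real_derivative dg \<tau>) (at 0 within {0..})"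
  using hyps unfolding standing_hyps_def by (auto simp: case_prod_unfold)

lemma K_section_measurable [measurable]: "\<tau> \<in> space M \<Longrightarrow> (\<lambda>s. K s \<tau>) \<in> borel_measurable borel"
  using measurable_compose[OF measurable_Pair2'[of \<tau> M lborel] K_measurable] by simp

lemma K_translate_measurable [measurable]:
  "(\<lambda>p. K (fst p + c) (snd p)) \<in> borel_measurable (lborel \<Otimes>\<^sub>M M)"
proof -
  have "(\<lambda>p. (fst p + c, snd p)) \<in> (lborel \<Otimes>\<^sub>M M) \<rightarrow>\<^sub>M (lborel \<Otimes>\<^sub>M M)" by simp
  from measurable_compose[OF this K_measurable] show ?thesis by simp
qed

lemma nn_integral_section_measurable:
  fixes f :: "real \<times> 'a \<Rightarrow> ennreal"
  assumes "f \<in> borel_measurable (lborel \<Otimes>\<^sub>M M)"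
  shows "(\<lambda>\<tau>. \<integral>\<^sup>+s. f (s, \<tau>) \<partial>lborel) \<in> borel_measurable M"
  using lborel.borel_measurable_nn_integral[of "\<lambda>\<tau> s. f (s, \<tau>)" M]
    measurable_compose[OF measurable_pair_swap' assms] by (simp add: case_prod_unfold)

text \<open>Measurability of \<open>g\<close> is assumed only on the half-line, so nonnegativity of
  \<open>\<phi>\<close> is what makes the composition measurable.\<close>

lemma g_comp_measurable:
  assumes "\<phi> \<in> borel_measurable borel" "\<And>t. 0 \<le> \<phi> t"
  shows "(\<lambda>p. g (\<phi> (t - fst p)) (snd p)) \<in> borel_measurable (lborel \<Otimes>\<^sub>M M)"
proof -
  note [measurable] = assms(1)
  have "(\<lambda>p. (\<phi> (t - fst p), snd p)) \<in> (lborel \<Otimes>\<^sub>M M) \<rightarrow>\<^sub>M (restrict_space borel {0..} \<Otimes>\<^sub>M M)"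
    by (intro measurable_Pair measurable_restrict_space2) (auto simp: assms(2))
  from measurable_compose[OF this g_measurable] show ?thesis by simp
qed

text \<open>Turns the linear bound of (C) on \<open>{0..B}\<close> into a bound independent of
  \<open>u\<close>, namely the function of (C) times \<open>B\<close>. Its product with
  \<open>K\<close> dominates the integrands of all solutions bounded by \<open>B\<close>.\<close>

lemma kernel_majorant:
  assumes "B > 0"
  obtains C where "C \<in> borel_measurable M" "\<And>\<tau>. \<tau> \<in> space M \<Longrightarrow> 0 \<le> C \<tau>"
    "\<And>u \<tau>. \<lbrakk>0 \<le> u; u \<le> B; \<tau> \<in> space M\<rbrakk> \<Longrightarrow> g u \<tau> \<le> C \<tau>"
    "(\<integral>\<^sup>+\<tau>. \<integral>\<^sup>+s. ennreal (K s \<tau> * C \<tau>) \<partial>lborel \<partial>M) < \<infinity>"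
proof -
  obtain C where C[measurable]: "C \<in> borel_measurable M" and C0: "\<forall>\<tau>\<in>space M. C \<tau> \<ge> 0"
    and gC: "\<forall>u\<in>{0..B}. \<forall>\<tau>\<in>space M. g u \<tau> \<le> C \<tau> * u"
    and fin: "(\<integral>\<^sup>+ \<tau>. ennreal (C \<tau>) * (\<integral>\<^sup>+ s. ennreal (K s \<tau>) \<partial>lborel) \<partial>M) < \<infinity>"
    using cond_C[unfolded cond_C_def, rule_format, OF \<open>B > 0\<close>] by - (elim exE conjE, rule that)
  have mK: "(\<lambda>\<tau>. \<integral>\<^sup>+ s. ennreal (K s \<tau>) \<partial>lborel) \<in> borel_measurable M"
    using nn_integral_section_measurable[of "\<lambda>p. ennreal (K (fst p) (snd p))"] by simp
  have "(\<integral>\<^sup>+\<tau>. \<integral>\<^sup>+s. ennreal (K s \<tau> * (C \<tau> * B)) \<partial>lborel \<partial>M)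
      = (\<integral>\<^sup>+\<tau>. ennreal B * (ennreal (C \<tau>) * (\<integral>\<^sup>+ s. ennreal (K s \<tau>) \<partial>lborel)) \<partial>M)"
  proof (intro nn_integral_cong)
    fix \<tau> assume \<tau>: "\<tau> \<in> space M"
    have "(\<integral>\<^sup>+s. ennreal (K s \<tau> * (C \<tau> * B)) \<partial>lborel) = (\<integral>\<^sup>+s. ennreal (C \<tau> * B) * ennreal (K s \<tau>) \<partial>lborel)"
      using \<tau> C0 \<open>B > 0\<close> by (intro nn_integral_cong) (simp add: K_nonneg mult.commute flip: ennreal_mult)
    also have "\<dots> = ennreal (C \<tau> * B) * (\<integral>\<^sup>+s. ennreal (K s \<tau>) \<partial>lborel)"
      using \<tau> by (intro nn_integral_cmult) simp
    finally show "(\<integral>\<^sup>+s. ennreal (K s \<tau> * (C \<tau> * B)) \<partial>lborel)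
        = ennreal B * (ennreal (C \<tau>) * (\<integral>\<^sup>+ s. ennreal (K s \<tau>) \<partial>lborel))"
      using \<tau> C0 \<open>B > 0\<close> by (simp add: ennreal_mult ac_simps)
  qed
  also have "\<dots> = ennreal B * (\<integral>\<^sup>+\<tau>. ennreal (C \<tau>) * (\<integral>\<^sup>+ s. ennreal (K s \<tau>) \<partial>lborel) \<partial>M)"
    using mK by (intro nn_integral_cmult) simp
  also have "\<dots> < \<infinity>" using fin by (simp add: ennreal_mult_less_top)
  finally have *: "(\<integral>\<^sup>+\<tau>. \<integral>\<^sup>+s. ennreal (K s \<tau> * (C \<tau> * B)) \<partial>lborel \<partial>M) < \<infinity>" .
  show ?thesis
  proof (rule that[of "\<lambda>\<tau>. C \<tau> * B"])
    fix u \<tau> assume u: "0 \<le> u" "u \<le> B" "\<tau> \<in> space M"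
    then have "g u \<tau> \<le> C \<tau> * u" using gC by simp
    also have "\<dots> \<le> C \<tau> * B" using u C0 by (intro mult_left_mono) auto
    finally show "g u \<tau> \<le> C \<tau> * B" .
  qed (use C0 \<open>B > 0\<close> * in auto)
qed

lemma iterated_eq_product:
  assumes [measurable]: "\<phi> \<in> borel_measurable borel" "\<And>t. 0 \<le> \<phi> t"
  shows "(\<integral>\<^sup>+\<tau>. \<integral>\<^sup>+s. ennreal (K s \<tau> * g (\<phi> (t - s)) \<tau>) \<partial>lborel \<partial>M)
    = (\<integral>\<^sup>+p. ennreal (K (fst p) (snd p) * g (\<phi> (t - fst p)) (snd p)) \<partial>(lborel \<Otimes>\<^sub>M M))"
proof -
  note [measurable] = g_comp_measurable[OF assms]
  show ?thesis
    by (subst P.nn_integral_snd[symmetric]) auto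
qed

text \<open>By Tonelli the iterated integral of (E) is one integral over the product space, the form
  in which dominated convergence and Fatou's lemma are applied to solutions.\<close>

lemma is_solution_product:
  "is_solution M K g \<phi> \<longleftrightarrow> continuous_on UNIV \<phi> \<and> (\<forall>t. \<phi> t \<ge> 0) \<and>
    (\<forall>t. ennreal (\<phi> t) =
      (\<integral>\<^sup>+p. ennreal (K (fst p) (snd p) * g (\<phi> (t - fst p)) (snd p)) \<partial>(lborel \<Otimes>\<^sub>M M)))"
  unfolding is_solution_def
  by (intro conj_cong refl)
    (subst iterated_eq_product, auto intro: borel_measurable_continuous_onI)

text \<open>For almost every \<open>\<tau>\<close> the inner integral tends to 0 by continuity of
  translations. Translation invariance bounds it by twice the integral of
  \<open>K s \<tau> * C \<tau>\<close>, independently of \<open>n\<close>, so dominated convergence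
  in \<open>\<tau>\<close> finishes.\<close>

lemma translation_modulus_tendsto:
  assumes C[measurable]: "C \<in> borel_measurable M" and C0: "\<And>\<tau>. \<tau> \<in> space M \<Longrightarrow> 0 \<le> C \<tau>"
    and fin: "(\<integral>\<^sup>+\<tau>. \<integral>\<^sup>+s. ennreal (K s \<tau> * C \<tau>) \<partial>lborel \<partial>M) < \<infinity>"
    and h: "h \<longlonglongrightarrow> (0::real)"
  shows "(\<lambda>n. \<integral>\<^sup>+p. ennreal (\<bar>K (fst p + h n) (snd p) - K (fst p) (snd p)\<bar> * C (snd p)) \<partial>(lborel \<Otimes>\<^sub>M M))
    \<longlonglongrightarrow> 0"
proof -
  have "(\<lambda>n. \<integral>\<^sup>+\<tau>. (\<integral>\<^sup>+s. ennreal (\<bar>K (s + h n) \<tau> - K s \<tau>\<bar> * C \<tau>) \<partial>lborel) \<partial>M) \<longlonglongrightarrow> (\<integral>\<^sup>+\<tau>. 0 \<partial>M)"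
  proof (rule nn_integral_dominated_convergence
      [where w="\<lambda>\<tau>. 2 * (\<integral>\<^sup>+s. ennreal (K s \<tau> * C \<tau>) \<partial>lborel)"])
    show "(\<lambda>\<tau>. \<integral>\<^sup>+s. ennreal (\<bar>K (s + h n) \<tau> - K s \<tau>\<bar> * C \<tau>) \<partial>lborel) \<in> borel_measurable M" for n
      using nn_integral_section_measurable[of "\<lambda>p. ennreal (\<bar>K (fst p + h n) (snd p) - K (fst p) (snd p)\<bar> * C (snd p))"] by simp
    have m2: "(\<lambda>\<tau>. \<integral>\<^sup>+s. ennreal (K s \<tau> * C \<tau>) \<partial>lborel) \<in> borel_measurable M"
      using nn_integral_section_measurable[of "\<lambda>p. ennreal (K (fst p) (snd p) * C (snd p))"] by simp
    then show "(\<lambda>\<tau>. 2 * (\<integral>\<^sup>+s. ennreal (K s \<tau> * C \<tau>) \<partial>lborel)) \<in> borel_measurable M" by simp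
    show "(\<integral>\<^sup>+\<tau>. 2 * (\<integral>\<^sup>+s. ennreal (K s \<tau> * C \<tau>) \<partial>lborel) \<partial>M) < \<infinity>"
      using fin m2 by (simp add: nn_integral_cmult ennreal_mult_less_top)
    show "AE \<tau> in M. (\<integral>\<^sup>+s. ennreal (\<bar>K (s + h n) \<tau> - K s \<tau>\<bar> * C \<tau>) \<partial>lborel)
        \<le> 2 * (\<integral>\<^sup>+s. ennreal (K s \<tau> * C \<tau>) \<partial>lborel)" for n
    proof (rule AE_I2)
      fix \<tau> assume \<tau>: "\<tau> \<in> space M"
      have "(\<integral>\<^sup>+s. ennreal (\<bar>K (s + h n) \<tau> - K s \<tau>\<bar> * C \<tau>) \<partial>lborel)
          \<le> (\<integral>\<^sup>+s. ennreal (K (s + h n) \<tau> * C \<tau>) + ennreal (K s \<tau> * C \<tau>) \<partial>lborel)"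
      proof (intro nn_integral_mono)
        fix s :: real
        have "\<bar>K (s + h n) \<tau> - K s \<tau>\<bar> * C \<tau> \<le> (K (s + h n) \<tau> + K s \<tau>) * C \<tau>"
          using \<tau> C0 K_nonneg[OF \<tau>, of s] K_nonneg[OF \<tau>, of "s + h n"] by (intro mult_right_mono) auto
        then show "ennreal (\<bar>K (s + h n) \<tau> - K s \<tau>\<bar> * C \<tau>) \<le> ennreal (K (s + h n) \<tau> * C \<tau>) + ennreal (K s \<tau> * C \<tau>)"
          using \<tau> C0 K_nonneg[OF \<tau>] by (simp add: distrib_right flip: ennreal_plus)
      qed
      also have "\<dots> = (\<integral>\<^sup>+s. ennreal (K (s + h n) \<tau> * C \<tau>) \<partial>lborel) + (\<integral>\<^sup>+s. ennreal (K s \<tau> * C \<tau>) \<partial>lborel)"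
        using \<tau> by (intro nn_integral_add) auto
      also have "(\<integral>\<^sup>+s. ennreal (K (s + h n) \<tau> * C \<tau>) \<partial>lborel) = (\<integral>\<^sup>+s. ennreal (K s \<tau> * C \<tau>) \<partial>lborel)"
        using \<tau> by (intro nn_integral_lborel_translate[where f="\<lambda>s. ennreal (K s \<tau> * C \<tau>)"]) simp
      finally show "(\<integral>\<^sup>+s. ennreal (\<bar>K (s + h n) \<tau> - K s \<tau>\<bar> * C \<tau>) \<partial>lborel)
        \<le> 2 * (\<integral>\<^sup>+s. ennreal (K s \<tau> * C \<tau>) \<partial>lborel)" by (simp add: mult_2)
    qed
    \<comment> \<open>Fubini yields integrable sections of \<open>K\<close> only for almost every
      \<open>\<tau>\<close>.\<close>
    show "AE \<tau> in M. (\<lambda>n. \<integral>\<^sup>+s. ennreal (\<bar>K (s + h n) \<tau> - K s \<tau>\<bar> * C \<tau>) \<partial>lborel) \<longlonglongrightarrow> 0"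
      using P.AE_integrable_snd[OF K_integrable]
    proof (rule AE_mp, intro AE_I2 impI)
      fix \<tau> assume \<tau>: "\<tau> \<in> space M" and "integrable lborel (\<lambda>s. K s \<tau>)"
      from ennreal_tendsto_cmult[OF _ L1_translation_tendsto[OF this(2) h], of "ennreal (C \<tau>)"]
      have "(\<lambda>n. ennreal (C \<tau>) * (\<integral>\<^sup>+s. ennreal \<bar>K (s + h n) \<tau> - K s \<tau>\<bar> \<partial>lborel)) \<longlonglongrightarrow> 0" by simp
      moreover have "ennreal (C \<tau>) * (\<integral>\<^sup>+s. ennreal \<bar>K (s + h n) \<tau> - K s \<tau>\<bar> \<partial>lborel)
          = (\<integral>\<^sup>+s. ennreal (\<bar>K (s + h n) \<tau> - K s \<tau>\<bar> * C \<tau>) \<partial>lborel)" for n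
        using \<tau> C0 by (subst nn_integral_cmult[symmetric])
          (auto intro!: nn_integral_cong simp: mult.commute simp flip: ennreal_mult)
      ultimately show "(\<lambda>n. \<integral>\<^sup>+s. ennreal (\<bar>K (s + h n) \<tau> - K s \<tau>\<bar> * C \<tau>) \<partial>lborel) \<longlonglongrightarrow> 0" by simp
    qed
  qed auto
  then show ?thesis
    by (subst P.nn_integral_snd[symmetric]) auto
qed

section \<open>Bounded solutions: uniform continuity, translates and limits\<close>

text \<open>A change of variable moves a shift of \<open>t\<close> from \<open>\<phi>\<close> onto
  the kernel. The increment of \<open>\<phi>\<close> is then controlled by the L1 modulus of the
  kernel weighted by \<open>C\<close>, which does not depend on \<open>t\<close>.\<close>

lemma bounded_solution_uniformly_continuous:
  assumes sol: "is_solution M K g \<phi>" and bd: "\<And>t. \<phi> t \<le> B"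
  shows "uniformly_continuous_on UNIV \<phi>"
proof -
  have \<phi>0: "0 \<le> \<phi> t" for t using sol by (simp add: is_solution_def)
  have m\<phi>[measurable]: "\<phi> \<in> borel_measurable borel"
    using sol by (simp add: is_solution_def borel_measurable_continuous_onI)
  note [measurable] = g_comp_measurable[OF m\<phi> \<phi>0]
  \<comment> \<open>Condition (C) requires a positive radius, whereas \<open>B\<close> may be
    0.\<close>
  have "max B 1 > 0" by simp
  then obtain C where C[measurable]: "C \<in> borel_measurable M"
    and C0: "\<And>\<tau>. \<tau> \<in> space M \<Longrightarrow> 0 \<le> C \<tau>"
    and gC: "\<And>u \<tau>. \<lbrakk>0 \<le> u; u \<le> max B 1; \<tau> \<in> space M\<rbrakk> \<Longrightarrow> g u \<tau> \<le> C \<tau>"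
    and fin: "(\<integral>\<^sup>+\<tau>. \<integral>\<^sup>+s. ennreal (K s \<tau> * C \<tau>) \<partial>lborel \<partial>M) < \<infinity>"
    by (rule kernel_majorant) blast
  define D where "D h = (\<integral>\<^sup>+p. ennreal (\<bar>K (fst p + h) (snd p) - K (fst p) (snd p)\<bar> * C (snd p)) \<partial>(lborel \<Otimes>\<^sub>M M))" for h
  have D: "(\<lambda>n. D (h n)) \<longlonglongrightarrow> 0" if "h \<longlonglongrightarrow> 0" for h
    unfolding D_def by (rule translation_modulus_tendsto[OF C C0 fin that])
  \<comment> \<open>A one-sided estimate, which avoids subtraction in the extended reals; the
    opposite inequality comes from the shift by \<open>- h\<close>.\<close>
  have modulus: "ennreal (\<phi> (t + h)) \<le> ennreal (\<phi> t) + D h" for t h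
  proof -
    have "ennreal (\<phi> (t + h)) = (\<integral>\<^sup>+\<tau>. \<integral>\<^sup>+s. ennreal (K s \<tau> * g (\<phi> (t + h - s)) \<tau>) \<partial>lborel \<partial>M)"
      using sol unfolding is_solution_def by blast
    also have "\<dots> = (\<integral>\<^sup>+\<tau>. \<integral>\<^sup>+s. ennreal (K (s + h) \<tau> * g (\<phi> (t - s)) \<tau>) \<partial>lborel \<partial>M)"
    proof (rule nn_integral_cong)
      fix \<tau> assume \<tau>: "\<tau> \<in> space M"
      have "(\<lambda>s. g (\<phi> (t + h - s)) \<tau>) \<in> borel_measurable borel"
        using measurable_compose[OF measurable_Pair2'[OF \<tau>, of lborel] g_comp_measurable[OF m\<phi> \<phi>0, of "t + h"]]
        by simp
      then show "(\<integral>\<^sup>+s. ennreal (K s \<tau> * g (\<phi> (t + h - s)) \<tau>) \<partial>lborel)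
          = (\<integral>\<^sup>+s. ennreal (K (s + h) \<tau> * g (\<phi> (t - s)) \<tau>) \<partial>lborel)"
        using nn_integral_lborel_translate[of "\<lambda>s. ennreal (K s \<tau> * g (\<phi> (t + h - s)) \<tau>)" h] \<tau>
        by simp
    qed
    also have "\<dots> = (\<integral>\<^sup>+p. ennreal (K (fst p + h) (snd p) * g (\<phi> (t - fst p)) (snd p)) \<partial>(lborel \<Otimes>\<^sub>M M))"
      by (subst P.nn_integral_snd[symmetric]) auto
    also have "\<dots> \<le> (\<integral>\<^sup>+p. ennreal (K (fst p) (snd p) * g (\<phi> (t - fst p)) (snd p))
        + ennreal (\<bar>K (fst p + h) (snd p) - K (fst p) (snd p)\<bar> * C (snd p)) \<partial>(lborel \<Otimes>\<^sub>M M))"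
    proof (intro nn_integral_mono)
      fix p :: "real \<times> 'a" assume "p \<in> space (lborel \<Otimes>\<^sub>M M)"
      then obtain s \<tau> where p: "p = (s, \<tau>)" and \<tau>: "\<tau> \<in> space M" by (auto simp: space_pair_measure)
      let ?u = "g (\<phi> (t - s)) \<tau>"
      have u: "0 \<le> ?u" "?u \<le> C \<tau>"
        using \<tau> \<phi>0 bd[of "t - s"] by (auto intro!: g_nonneg gC)
      have "K (s + h) \<tau> * ?u \<le> K s \<tau> * ?u + \<bar>K (s + h) \<tau> - K s \<tau>\<bar> * ?u"
        using u by (simp add: mult_right_mono flip: distrib_right)
      also have "\<dots> \<le> K s \<tau> * ?u + \<bar>K (s + h) \<tau> - K s \<tau>\<bar> * C \<tau>"
        using u by (intro add_left_mono mult_left_mono) auto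
      finally show "ennreal (K (fst p + h) (snd p) * g (\<phi> (t - fst p)) (snd p))
        \<le> ennreal (K (fst p) (snd p) * g (\<phi> (t - fst p)) (snd p))
        + ennreal (\<bar>K (fst p + h) (snd p) - K (fst p) (snd p)\<bar> * C (snd p))"
        using u \<tau> C0 K_nonneg[OF \<tau>] by (simp add: p flip: ennreal_plus)
    qed
    also have "\<dots> = ennreal (\<phi> t) + D h"
      using sol unfolding is_solution_product D_def by (subst nn_integral_add) auto
    finally show ?thesis .
  qed
  show ?thesis
    unfolding uniformly_continuous_on_sequentially
  proof (intro allI impI)
    fix x y :: "nat \<Rightarrow> real"
    assume "(\<forall>n. x n \<in> UNIV) \<and> (\<forall>n. y n \<in> UNIV) \<and> (\<lambda>n. dist (x n) (y n)) \<longlonglongrightarrow> 0"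
    then have h': "(\<lambda>n. - (y n - x n)) \<longlonglongrightarrow> 0"
      by (simp add: dist_real_def tendsto_rabs_zero_iff)
    then have h: "(\<lambda>n. y n - x n) \<longlonglongrightarrow> 0"
      using tendsto_minus[OF h'] by simp
    have DD: "(\<lambda>n. D (y n - x n) + D (- (y n - x n))) \<longlonglongrightarrow> 0"
      using tendsto_add[OF D[OF h] D[OF h']] by simp
    \<comment> \<open>The sum of both moduli covers either sign of the difference.\<close>
    have "ennreal (dist (\<phi> (x n)) (\<phi> (y n))) \<le> D (y n - x n) + D (- (y n - x n))" for n
    proof -
      have *: "ennreal (a - b) \<le> d" if "ennreal a \<le> ennreal b + d" "0 \<le> b" for a b d
      proof (cases d)
        case (real r)
        then show ?thesis using that by (auto simp: ennreal_le_iff2 simp flip: ennreal_plus)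
      qed simp
      have "ennreal (\<phi> (y n) - \<phi> (x n)) \<le> D (y n - x n)"
        using modulus[of "x n" "y n - x n"] by (intro * \<phi>0) simp
      moreover have "ennreal (\<phi> (x n) - \<phi> (y n)) \<le> D (- (y n - x n))"
        using modulus[of "y n" "- (y n - x n)"] by (intro * \<phi>0) simp
      ultimately show ?thesis
        by (cases "\<phi> (x n) \<le> \<phi> (y n)")
          (auto simp: dist_real_def abs_if intro: order_trans add_increasing add_increasing2)
    qed
    then have "(\<lambda>n. ennreal (dist (\<phi> (x n)) (\<phi> (y n)))) \<longlonglongrightarrow> ennreal 0"
      using tendsto_sandwich[OF _ _ tendsto_const DD, of "\<lambda>n. ennreal (dist (\<phi> (x n)) (\<phi> (y n)))"]
      by simp
    then show "(\<lambda>n. dist (\<phi> (x n)) (\<phi> (y n))) \<longlonglongrightarrow> 0"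
      by (subst (asm) tendsto_ennreal_iff) auto
  qed
qed

lemma solution_translate:
  assumes "is_solution M K g \<phi>"
  shows "is_solution M K g (\<lambda>t. \<phi> (c + t))"
proof -
  have "continuous_on UNIV (\<lambda>t. \<phi> (c + t))"
    using assms unfolding is_solution_def
    by (auto intro!: continuous_on_compose2[of UNIV \<phi>] continuous_intros)
  moreover have "ennreal (\<phi> (c + t)) =
      (\<integral>\<^sup>+\<tau>. \<integral>\<^sup>+s. ennreal (K s \<tau> * g (\<phi> (c + (t - s))) \<tau>) \<partial>lborel \<partial>M)" for t
    using assms unfolding is_solution_def by (simp add: add_diff_eq)
  ultimately show ?thesis using assms unfolding is_solution_def by auto
qed

text \<open>The common bound \<open>B\<close> gives one majorant for all \<open>f n\<close>, and
  continuity of \<open>g\<close> in its first argument gives pointwise convergence of the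
  integrands; both sides of (E) then converge.\<close>

lemma solution_limit:
  assumes sol: "\<And>n. is_solution M K g (f n)" and bd: "\<And>n t. f n t \<le> B"
    and lim: "\<And>t. (\<lambda>n. f n t) \<longlonglongrightarrow> \<psi> t" and cont: "continuous_on UNIV \<psi>"
  shows "is_solution M K g \<psi>"
proof -
  have f0: "0 \<le> f n t" for n t using sol by (simp add: is_solution_def)
  have \<psi>0: "0 \<le> \<psi> t" for t using LIMSEQ_le_const[OF lim] f0 by blast
  have mf: "f n \<in> borel_measurable borel" for n
    using sol by (simp add: is_solution_def borel_measurable_continuous_onI)
  have m\<psi>: "\<psi> \<in> borel_measurable borel"
    using cont by (simp add: borel_measurable_continuous_onI)
  note [measurable] = g_comp_measurable[OF mf f0] g_comp_measurable[OF m\<psi> \<psi>0]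
  have "max B 1 > 0" by simp
  then obtain C where C[measurable]: "C \<in> borel_measurable M"
    and C0: "\<And>\<tau>. \<tau> \<in> space M \<Longrightarrow> 0 \<le> C \<tau>"
    and gC: "\<And>u \<tau>. \<lbrakk>0 \<le> u; u \<le> max B 1; \<tau> \<in> space M\<rbrakk> \<Longrightarrow> g u \<tau> \<le> C \<tau>"
    and fin: "(\<integral>\<^sup>+\<tau>. \<integral>\<^sup>+s. ennreal (K s \<tau> * C \<tau>) \<partial>lborel \<partial>M) < \<infinity>"
    by (rule kernel_majorant) blast
  have "ennreal (\<psi> t) =
      (\<integral>\<^sup>+p. ennreal (K (fst p) (snd p) * g (\<psi> (t - fst p)) (snd p)) \<partial>(lborel \<Otimes>\<^sub>M M))" for t
  proof -
    have "(\<lambda>n. \<integral>\<^sup>+p. ennreal (K (fst p) (snd p) * g (f n (t - fst p)) (snd p)) \<partial>(lborel \<Otimes>\<^sub>M M))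
      \<longlonglongrightarrow> (\<integral>\<^sup>+p. ennreal (K (fst p) (snd p) * g (\<psi> (t - fst p)) (snd p)) \<partial>(lborel \<Otimes>\<^sub>M M))"
    proof (rule nn_integral_dominated_convergence[where w="\<lambda>p. ennreal (K (fst p) (snd p) * C (snd p))"])
      show "(\<integral>\<^sup>+p. ennreal (K (fst p) (snd p) * C (snd p)) \<partial>(lborel \<Otimes>\<^sub>M M)) < \<infinity>"
        using fin by (subst P.nn_integral_snd[symmetric]) auto
      show "AE p in lborel \<Otimes>\<^sub>M M. ennreal (K (fst p) (snd p) * g (f n (t - fst p)) (snd p))
          \<le> ennreal (K (fst p) (snd p) * C (snd p))" for n
        using f0 bd by (intro AE_I2 ennreal_leI mult_left_mono gC K_nonneg)
          (auto simp: space_pair_measure le_max_iff_disj)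
      show "AE p in lborel \<Otimes>\<^sub>M M. (\<lambda>n. ennreal (K (fst p) (snd p) * g (f n (t - fst p)) (snd p)))
          \<longlonglongrightarrow> ennreal (K (fst p) (snd p) * g (\<psi> (t - fst p)) (snd p))"
      proof (rule AE_I2)
        fix p :: "real \<times> 'a" assume "p \<in> space (lborel \<Otimes>\<^sub>M M)"
        then have "snd p \<in> space M" by (auto simp: space_pair_measure)
        from continuous_on_tendsto_compose[OF g_continuous[OF this] lim, of "t - fst p"]
        have "(\<lambda>n. g (f n (t - fst p)) (snd p)) \<longlonglongrightarrow> g (\<psi> (t - fst p)) (snd p)"
          using f0 \<psi>0 by simp
        then show "(\<lambda>n. ennreal (K (fst p) (snd p) * g (f n (t - fst p)) (snd p)))
          \<longlonglongrightarrow> ennreal (K (fst p) (snd p) * g (\<psi> (t - fst p)) (snd p))"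
          by (intro tendsto_ennrealI tendsto_intros)
      qed
    qed auto
    then have "(\<lambda>n. ennreal (f n t))
      \<longlonglongrightarrow> (\<integral>\<^sup>+p. ennreal (K (fst p) (snd p) * g (\<psi> (t - fst p)) (snd p)) \<partial>(lborel \<Otimes>\<^sub>M M))"
      using sol unfolding is_solution_product by simp
    then show ?thesis
      using LIMSEQ_unique tendsto_ennrealI[OF lim] by blast
  qed
  then show ?thesis using cont \<psi>0 by (simp add: is_solution_product)
qed

section \<open>Uniform propagation of small values\<close>

text \<open>The point is that \<open>\<delta>\<close> is uniform in \<open>t\<close>. Otherwise
  translates at points where \<open>\<phi>\<close> is ever smaller converge to a bounded solution
  vanishing at 0, hence identically zero by (P), although offsets of size at most \<open>N\<close>
  carry values at least \<open>\<epsilon>\<close>.\<close>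

lemma small_values_propagate:
  assumes P: "cond_P M K g" and sol: "is_solution M K g \<phi>" and bd: "\<And>t. \<phi> t \<le> B" and "\<epsilon> > 0"
  shows "\<exists>\<delta>>0. \<forall>t s. \<phi> t < \<delta> \<longrightarrow> \<bar>s\<bar> \<le> N \<longrightarrow> \<phi> (t + s) < \<epsilon>"
proof (rule ccontr)
  assume neg: "\<not> ?thesis"
  have \<phi>0: "0 \<le> \<phi> t" for t using sol by (simp add: is_solution_def)
  have uc: "uniformly_continuous_on UNIV \<phi>"
    using bounded_solution_uniformly_continuous[OF sol bd] .
  have "\<exists>t s. \<phi> t < 1 / real (Suc n) \<and> \<bar>s\<bar> \<le> N \<and> \<epsilon> \<le> \<phi> (t + s)" for n
  proof -
    have "1 / real (Suc n) > 0" by simp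
    with neg show ?thesis by (meson not_less)
  qed
  then obtain t s where t: "\<And>n. \<phi> (t n) < 1 / real (Suc n)"
    and s: "\<And>n. \<bar>s n\<bar> \<le> N" and ts: "\<And>n. \<epsilon> \<le> \<phi> (t n + s n)"
    by metis
  have "bounded (range s)" using s by (auto simp: bounded_iff)
  then obtain c k where k: "strict_mono (k :: nat \<Rightarrow> nat)" and c: "(s \<circ> k) \<longlonglongrightarrow> c"
    using bounded_imp_convergent_subsequence by blast
  obtain r \<psi> where r: "strict_mono (r :: nat \<Rightarrow> nat)" and \<psi>: "continuous_on UNIV \<psi>"
    and lim: "\<And>x. (\<lambda>n. \<phi> (t (k (r n)) + x)) \<longlonglongrightarrow> \<psi> x"
    using uniformly_continuous_translates_subsequence[OF uc, of B "t \<circ> k"] bd \<phi>0 by auto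
  have "is_solution M K g \<psi>"
    using solution_translate[OF sol] bd lim \<psi> by (rule solution_limit)
  moreover have "bounded (range \<psi>)"
  proof -
    have "\<psi> x \<in> {0..B}" for x
      using LIMSEQ_le_const[OF lim[of x]] LIMSEQ_le_const2[OF lim[of x]] \<phi>0 bd by auto
    then show ?thesis by (meson bounded_closed_interval bounded_subset image_subsetI)
  qed
  moreover have "\<psi> 0 = 0"
  proof -
    have inv: "(\<lambda>n. 1 / real (Suc n)) \<longlonglongrightarrow> 0" by (rule LIMSEQ_Suc[OF lim_1_over_n])
    have "(\<lambda>n. \<phi> (t n)) \<longlonglongrightarrow> 0"
    proof (rule tendsto_sandwich[OF _ _ tendsto_const inv])
      show "\<forall>\<^sub>F n in sequentially. \<phi> (t n) \<le> 1 / real (Suc n)"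
        using less_imp_le[OF t] by (rule always_eventually[OF allI])
    qed (use \<phi>0 in auto)
    from LIMSEQ_subseq_LIMSEQ[OF this strict_mono_o[OF k r]]
    show ?thesis using lim[of 0] LIMSEQ_unique by (simp add: o_def)
  qed
  ultimately have "\<psi> c = 0" using P unfolding cond_P_def by blast
  \<comment> \<open>The translates converge only pointwise, so the moving offsets are replaced by
    their limit \<open>c\<close> through uniform continuity of \<open>\<phi>\<close>.\<close>
  have "(\<lambda>n. dist (t (k (r n)) + s (k (r n))) (t (k (r n)) + c)) \<longlonglongrightarrow> 0"
    using tendsto_dist_iff[THEN iffD1, OF LIMSEQ_subseq_LIMSEQ[OF c r]] by (simp add: o_def)
  then have "(\<lambda>n. dist (\<phi> (t (k (r n)) + s (k (r n)))) (\<phi> (t (k (r n)) + c))) \<longlonglongrightarrow> 0"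
    using uc[unfolded uniformly_continuous_on_sequentially, rule_format,
        of "\<lambda>n. t (k (r n)) + s (k (r n))" "\<lambda>n. t (k (r n)) + c"] by simp
  then have "(\<lambda>n. \<phi> (t (k (r n)) + s (k (r n))) - \<phi> (t (k (r n)) + c)) \<longlonglongrightarrow> 0"
    by (simp add: dist_real_def tendsto_rabs_zero_iff)
  from tendsto_add[OF this lim[of c]] \<open>\<psi> c = 0\<close>
  have "(\<lambda>n. \<phi> (t (k (r n)) + s (k (r n)))) \<longlonglongrightarrow> 0" by simp
  then have "\<epsilon> \<le> 0" using ts by (intro LIMSEQ_le_const) auto
  with \<open>\<epsilon> > 0\<close> show False by simp
qed

section \<open>Excluding arbitrarily deep dips\<close>

text \<open>Equation (E) at \<open>m n\<close>, divided by \<open>\<phi> (m n)\<close>, says that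
  \<open>u n\<close> has integral 1. The pointwise lower limit of \<open>u n\<close> is at least
  \<open>K s \<tau> * dg \<tau>\<close>, so by Fatou the integral defining \<open>chi0_neg\<close>
  is at most 1.\<close>

lemma no_vanishing_local_minima:
  assumes chi: "chi0_neg M K dg" and sol: "is_solution M K g \<phi>" and pos: "\<And>t. 0 < \<phi> t"
    and min: "\<And>n s. \<bar>s\<bar> \<le> real n \<Longrightarrow> \<phi> (m n) \<le> \<phi> (m n + s)"
    and small: "\<And>n s. \<bar>s\<bar> \<le> real n \<Longrightarrow> \<phi> (m n + s) < 1 / real (Suc n)"
  shows False
proof -
  have \<phi>0: "0 \<le> \<phi> t" for t using pos less_imp_le by blast
  have m\<phi>: "\<phi> \<in> borel_measurable borel"
    using sol by (simp add: is_solution_def borel_measurable_continuous_onI)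
  note [measurable] = g_comp_measurable[OF m\<phi> \<phi>0]
  define u where "u n p = ennreal (K (fst p) (snd p) * g (\<phi> (m n - fst p)) (snd p) / \<phi> (m n))" for n and p :: "real \<times> 'a"
  have [measurable]: "u n \<in> borel_measurable (lborel \<Otimes>\<^sub>M M)" for n
    unfolding u_def by measurable
  have u1: "(\<integral>\<^sup>+p. u n p \<partial>(lborel \<Otimes>\<^sub>M M)) = 1" for n
  proof -
    have "(\<integral>\<^sup>+p. u n p \<partial>(lborel \<Otimes>\<^sub>M M)) = (\<integral>\<^sup>+p. ennreal (1 / \<phi> (m n)) *
        ennreal (K (fst p) (snd p) * g (\<phi> (m n - fst p)) (snd p)) \<partial>(lborel \<Otimes>\<^sub>M M))"
      unfolding u_def using \<phi>0
      by (intro nn_integral_cong) (auto simp: space_pair_measure K_nonneg g_nonneg simp flip: ennreal_mult)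
    also have "\<dots> = ennreal (1 / \<phi> (m n)) * ennreal (\<phi> (m n))"
      using sol unfolding is_solution_product by (subst nn_integral_cmult) auto
    also have "\<dots> = 1" using pos[of "m n"] by (simp flip: ennreal_mult)
    finally show ?thesis .
  qed
  have le: "ennreal (K s \<tau> * dg \<tau>) \<le> liminf (\<lambda>n. u n (s, \<tau>))" if \<tau>: "\<tau> \<in> space M" for s \<tau>
  proof -
    \<comment> \<open>From \<open>n0\<close> on the offset \<open>- s\<close> lies in the window of
      radius \<open>n\<close>, so minimality and smallness both apply to it.\<close>
    obtain n0 where n0: "\<bar>s\<bar> \<le> real n0" using real_arch_simple by blast
    define x where "x n = \<phi> (m n - s)" for n
    have x: "\<phi> (m n) \<le> x n" "x n < 1 / real (Suc n)" if "n \<ge> n0" for n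
      using min[of "- s" n] small[of "- s" n] n0 that by (auto simp: x_def)
    have inv: "(\<lambda>n. 1 / real (Suc n)) \<longlonglongrightarrow> 0" by (rule LIMSEQ_Suc[OF lim_1_over_n])
    have "x \<longlonglongrightarrow> 0"
    proof (rule tendsto_sandwich[OF _ _ tendsto_const inv])
      show "\<forall>\<^sub>F n in sequentially. x n \<le> 1 / real (Suc n)"
        using x(2) less_imp_le unfolding eventually_sequentially by blast
    qed (use \<phi>0 in \<open>auto simp: x_def\<close>)
    \<comment> \<open>Strict positivity keeps \<open>x n\<close> away from 0 itself, as the limit of
      the difference quotient demands.\<close>
    then have "filterlim x (at 0 within {0..}) sequentially"
      using pos \<phi>0 by (auto simp: filterlim_at x_def less_imp_neq[symmetric])
    moreover have "((\<lambda>y. g y \<tau> / y) \<longlongrightarrow> dg \<tau>) (at 0 within {0..})"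
      using g_deriv[OF \<tau>] g_zero[OF \<tau>] by (simp add: has_field_derivative_iff)
    ultimately have "(\<lambda>n. g (x n) \<tau> / x n) \<longlonglongrightarrow> dg \<tau>"
      by (rule filterlim_compose[rotated])
    then have "(\<lambda>n. ennreal (K s \<tau> * (g (x n) \<tau> / x n))) \<longlonglongrightarrow> ennreal (K s \<tau> * dg \<tau>)"
      by (intro tendsto_ennrealI tendsto_intros)
    then have "ennreal (K s \<tau> * dg \<tau>) = liminf (\<lambda>n. ennreal (K s \<tau> * (g (x n) \<tau> / x n)))"
      by (simp add: lim_imp_Liminf)
    also have "\<dots> \<le> liminf (\<lambda>n. u n (s, \<tau>))"
    proof (rule Liminf_mono, unfold eventually_sequentially, intro exI allI impI)
      fix n assume n: "n \<ge> n0"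
      \<comment> \<open>Minimality enters here: the denominator \<open>x n\<close> is replaced by
        the smaller \<open>\<phi> (m n)\<close>.\<close>
      have "g (x n) \<tau> / x n \<le> g (x n) \<tau> / \<phi> (m n)"
        using x(1)[OF n] pos \<phi>0 \<tau> by (intro divide_left_mono g_nonneg mult_pos_pos) (auto simp: x_def)
      from mult_left_mono[OF this K_nonneg[OF \<tau>, of s]]
      show "ennreal (K s \<tau> * (g (x n) \<tau> / x n)) \<le> u n (s, \<tau>)"
        by (simp add: u_def x_def ennreal_leI)
    qed
    finally show ?thesis .
  qed
  have "(\<integral>\<^sup>+\<tau>. \<integral>\<^sup>+s. ennreal (K s \<tau> * dg \<tau>) \<partial>lborel \<partial>M)
      \<le> (\<integral>\<^sup>+\<tau>. \<integral>\<^sup>+s. liminf (\<lambda>n. u n (s, \<tau>)) \<partial>lborel \<partial>M)"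
    by (intro nn_integral_mono le)
  also have "\<dots> = (\<integral>\<^sup>+p. liminf (\<lambda>n. u n p) \<partial>(lborel \<Otimes>\<^sub>M M))"
    by (rule P.nn_integral_snd) simp
  also have "\<dots> \<le> liminf (\<lambda>n. \<integral>\<^sup>+p. u n p \<partial>(lborel \<Otimes>\<^sub>M M))"
    by (rule nn_integral_liminf) simp
  also have "\<dots> = 1" by (simp add: u1 Liminf_const)
  finally have "enn2real (\<integral>\<^sup>+\<tau>. \<integral>\<^sup>+s. ennreal (K s \<tau> * dg \<tau>) \<partial>lborel \<partial>M) \<le> 1"
    using enn2real_mono[of _ 1] by simp
  with chi show False unfolding chi0_neg_def Let_def by simp
qed

text \<open>If dips between \<open>\<epsilon>\<close>-high points were arbitrarily deep, their
  minimum points would satisfy the hypotheses of the preceding lemma.\<close>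

lemma dips_bounded_below:
  assumes P: "cond_P M K g" and chi: "chi0_neg M K dg" and sol: "is_solution M K g \<phi>"
    and bd: "\<And>t. \<phi> t \<le> B" and pos: "\<And>t. 0 < \<phi> t" and "\<epsilon> > 0"
  shows "\<exists>\<delta>>0. \<forall>p t q. p < t \<longrightarrow> t < q \<longrightarrow> \<epsilon> \<le> \<phi> p \<longrightarrow> \<epsilon> \<le> \<phi> q \<longrightarrow> \<delta> \<le> \<phi> t"
proof (rule ccontr)
  assume no: "\<not> ?thesis"
  have "\<exists>m. \<forall>s. \<bar>s\<bar> \<le> real n \<longrightarrow> \<phi> m \<le> \<phi> (m + s) \<and> \<phi> (m + s) < 1 / real (Suc n)" for n
  proof -
    \<comment> \<open>The bound \<open>\<epsilon>\<close> will keep \<open>p\<close> and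
      \<open>q\<close> outside the window around the minimum point, and
      \<open>1 / real (Suc n)\<close> makes the values there tend to 0.\<close>
    have "min \<epsilon> (1 / real (Suc n)) > 0" using \<open>\<epsilon> > 0\<close> by simp
    from small_values_propagate[OF P sol bd this, of "real n"]
    obtain \<delta> where "\<delta> > 0"
      and \<delta>: "\<And>t s. \<phi> t < \<delta> \<Longrightarrow> \<bar>s\<bar> \<le> real n \<Longrightarrow> \<phi> (t + s) < min \<epsilon> (1 / real (Suc n))" by blast
    then obtain p t q where ptq: "p < t" "t < q" "\<epsilon> \<le> \<phi> p" "\<epsilon> \<le> \<phi> q" "\<phi> t < \<delta>"
      using no by (meson not_less)
    have "continuous_on {p..q} \<phi>"
      using sol unfolding is_solution_def by (meson continuous_on_subset subset_UNIV)
    then obtain m where m: "m \<in> {p..q}" and mmin: "\<And>y. y \<in> {p..q} \<Longrightarrow> \<phi> m \<le> \<phi> y"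
      using continuous_attains_inf[of "{p..q}" \<phi>] ptq by auto
    have "\<phi> m < \<delta>" using mmin[of t] ptq by simp
    note near = \<delta>[OF this]
    \<comment> \<open>An endpoint within distance \<open>n\<close> of \<open>m\<close> would have a
      value below \<open>\<epsilon>\<close> by propagation. So the whole window lies in
      \<open>{p..q}\<close>, where \<open>m\<close> is a minimum point.\<close>
    have "p < m - real n" using near[of "p - m"] m ptq(3) by (cases "p < m - real n") auto
    moreover have "m + real n < q" using near[of "q - m"] m ptq(4) by (cases "m + real n < q") auto
    ultimately show ?thesis using near mmin by (intro exI[of _ m]) (auto simp: abs_le_iff)
  qed
  then obtain m where "\<And>n s. \<bar>s\<bar> \<le> real n \<Longrightarrow> \<phi> (m n) \<le> \<phi> (m n + s)"
    "\<And>n s. \<bar>s\<bar> \<le> real n \<Longrightarrow> \<phi> (m n + s) < 1 / real (Suc n)" by metis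
  then show False by (rule no_vanishing_local_minima[OF chi sol pos])
qed

end

section \<open>The dichotomy at both ends of the line\<close>

theorem theorem1p3:
  fixes M :: "'a measure" and K g :: "real \<Rightarrow> 'a \<Rightarrow> real" and dg :: "'a \<Rightarrow> real"
    and \<phi> :: "real \<Rightarrow> real"
  assumes "standing_hyps M K g dg"
    and "cond_C M K g" and "cond_P M K g"
    and "chi0_neg M K dg"
    and "is_solution M K g \<phi>" and "bounded (range \<phi>)" and "\<forall>t. \<phi> t \<ge> 0"
  shows "(Liminf at_top (\<lambda>t. ereal (\<phi> t)) > 0 \<or> (\<phi> \<longlongrightarrow> 0) at_top) \<and>
         (Liminf at_bot (\<lambda>t. ereal (\<phi> t)) > 0 \<or> (\<phi> \<longlongrightarrow> 0) at_bot)"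
proof (cases "\<exists>t. \<phi> t = 0")
  case True
  \<comment> \<open>By (P) a single zero forces the zero solution; in the other case
    \<open>\<phi>\<close> is strictly positive, so division by its values is possible.\<close>
  then have "\<phi> = (\<lambda>_. 0)" using assms(3,5,6) unfolding cond_P_def by blast
  then show ?thesis by simp
next
  case False
  then have pos: "0 < \<phi> t" for t using assms(7) by (simp add: order_less_le)
  interpret convolution_equation M K g dg using assms(1,2) by unfold_locales
  obtain B where B: "\<And>t. \<phi> t \<le> B"
    using assms(6) unfolding bounded_iff by (auto intro: order_trans[OF abs_ge_self])
  have big: "\<exists>\<epsilon>>0. \<exists>\<^sub>F t in F. \<epsilon> \<le> \<phi> t" if "\<not> (\<phi> \<longlongrightarrow> 0) F" for F
    using that assms(7) unfolding tendsto_iff frequently_def by (auto simp: not_le)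
  have Liminf_pos: "0 < Liminf F (\<lambda>t. ereal (\<phi> t))" if "\<forall>\<^sub>F t in F. \<delta> \<le> \<phi> t" "\<delta> > 0" for F \<delta>
  proof -
    have "ereal \<delta> \<le> Liminf F (\<lambda>t. ereal (\<phi> t))" using that(1) by (intro Liminf_bounded) simp
    with \<open>\<delta> > 0\<close> show ?thesis by (metis ereal_less(2) less_le_trans)
  qed
  have "0 < Liminf at_top (\<lambda>t. ereal (\<phi> t))" if nt: "\<not> (\<phi> \<longlongrightarrow> 0) at_top"
  proof -
    obtain \<epsilon> where "\<epsilon> > 0" and fr: "\<exists>\<^sub>F t in at_top. \<epsilon> \<le> \<phi> t" using big[OF nt] by blast
    obtain \<delta> where "\<delta> > 0"
      and \<delta>: "\<forall>p t q. p < t \<longrightarrow> t < q \<longrightarrow> \<epsilon> \<le> \<phi> p \<longrightarrow> \<epsilon> \<le> \<phi> q \<longrightarrow> \<delta> \<le> \<phi> t"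
      using dips_bounded_below[OF assms(3-5) B pos \<open>\<epsilon> > 0\<close>] by blast
    have ex: "\<exists>q>t. \<epsilon> \<le> \<phi> q" for t
      using fr eventually_gt_at_top[of t] unfolding frequently_def by (metis (mono_tags, lifting) eventually_mono)
    then obtain p where p: "\<epsilon> \<le> \<phi> p" by blast
    \<comment> \<open>One fixed \<open>p\<close> suffices on the left: every \<open>t\<close> beyond
      it has a further point to its right with value at least \<open>\<epsilon>\<close>.\<close>
    have "\<forall>\<^sub>F t in at_top. \<delta> \<le> \<phi> t"
      using eventually_gt_at_top[of p] by eventually_elim (use ex p \<delta> in blast)
    then show ?thesis using Liminf_pos \<open>\<delta> > 0\<close> by blast
  qed
  moreover have "0 < Liminf at_bot (\<lambda>t. ereal (\<phi> t))" if nt: "\<not> (\<phi> \<longlongrightarrow> 0) at_bot"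
  proof -
    obtain \<epsilon> where "\<epsilon> > 0" and fr: "\<exists>\<^sub>F t in at_bot. \<epsilon> \<le> \<phi> t" using big[OF nt] by blast
    obtain \<delta> where "\<delta> > 0"
      and \<delta>: "\<forall>p t q. p < t \<longrightarrow> t < q \<longrightarrow> \<epsilon> \<le> \<phi> p \<longrightarrow> \<epsilon> \<le> \<phi> q \<longrightarrow> \<delta> \<le> \<phi> t"
      using dips_bounded_below[OF assms(3-5) B pos \<open>\<epsilon> > 0\<close>] by blast
    have ex: "\<exists>p<t. \<epsilon> \<le> \<phi> p" for t
      using fr eventually_gt_at_bot[of t] unfolding frequently_def by (metis (mono_tags, lifting) eventually_mono)
    then obtain q where q: "\<epsilon> \<le> \<phi> q" by blast
    \<comment> \<open>Mirror image: \<open>q\<close> is fixed on the right, and the left endpoint is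
      chosen after \<open>t\<close>.\<close>
    have "\<forall>\<^sub>F t in at_bot. \<delta> \<le> \<phi> t"
      using eventually_gt_at_bot[of q] by eventually_elim (use ex q \<delta> in blast)
    then show ?thesis using Liminf_pos \<open>\<delta> > 0\<close> by blast
  qed
  ultimately show ?thesis by blast
qed

end
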